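(* Let $s\in\mathbb{R}^n$ and $\delta>0$. Apply the Fast Iterative Filtering (FIF) algorithm to $s$ with stopping parameter $\delta$, using double convolution filters, and suppose it returns the decomposition $$s=\sum_{k=1}^m \mathrm{IMF}_k + r,$$ where $r$ is the trend (the final remainder). Then: (i) the decomposition preserves the $L_1$ Fourier energy, i.e. $E_1(s)=\sum_{k=1}^m E_1(\mathrm{IMF}_k)+E_1(r)$; (ii) the decomposition contains no unwanted oscillations, i.e. for every sampling frequency $\xi$ one has $\sum_{k=1}^m |\widehat{\mathrm{IMF}_k}(\xi)|+|\widehat{r}(\xi)|\le |\widehat{s}(\xi)|$.
   Context: **Signals and DFT.** A signal is a vector $s=(s_j)_{j=0}^{n-1}\in\mathbb{R}^n$, viewed as samples $s_j=s(t_j)$ on $[0,L]$ with $t_j=j/(2B)$, $n=2BL$, and extended periodically. Its discrete Fourier transform is $\widehat{s}(\xi_k)=\sum_{j=0}^{n-1}s_j e^{-2\pi i t_j\xi_k}=\sum_{j=0}^{n-1}s_j e^{-2\pi i jk/n}$, at the sampling frequencies $\xi_k=k/L$, $k=0,\dots,n-1$. The normalized 2-norm is $\|a\|_2=\frac{L}{n}\left(\sum_j|a_j|^2\right)^{1/2}$. **$L_1$ Fourier energy.** $E_1(s)=\|\widehat s\|_1=\sum_k|\widehat{s}(\xi_k)|$. A decomposition $s=\sum_k\phi_k$ conserves the $L_1$ Fourier energy if $E_1(s)=\sum_k E_1(\phi_k)$. **Unwanted oscillations.** A decomposition $s=\sum_k\phi_k$ contains unwanted oscillations if there is a sampling frequency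 $\xi$ with $\sum_k|\widehat{\phi}_k(\xi)|>|\widehat{s}(\xi)|$. **Filters.** A (discrete, periodized) filter is a vector $\tilde w\in\mathbb{R}^n$, indexed modulo $n$, that is nonnegative, even ($\tilde w_{-j}=\tilde w_j$) and satisfies $\sum_j\tilde w_j=1$. A double convolution filter is $w=\tilde w*\tilde w$ (circular convolution) for some filter $\tilde w$. **Variation operator.** For a double convolution filter $w$, $\mathcal{V}_w s=s-w*s$ (circular convolution), so that $\widehat{\mathcal{V}_w^p s}(\xi)=(1-\widehat w(\xi))^p\,\widehat s(\xi)$ for every $p\ge 0$. **FIF algorithm with parameter $\delta$.** Put $s^{(1)}=s$. For $k=1,2,\dots$, as long as $s^{(k)}$ has at least two extrema: choose, by any rule based on $s^{(k)}$, a double convolution filter $w_k$ (its length being computed from $s^{(k)}$); let $p_k$ be the first positive integer $p$ at which the stopping criterion $\|\widehat{\mathcal{V}_{w_k}^{p+1}s^{(k)}}-\widehat{\mathcal{V}_{w_k}^{p}s^{(k)}}\|_2\le\delta\|s^{(k)}\|_2$ holds; set $\mathrm{IMF}_k=\mathcal{V}_{w_k}^{p_k}s^{(k)}$ and $s^{(k+1)}=s^{(k)}-\mathrm{IMF}_k$. If the procedure stops after $m$ steps, because $s^{(m+1)}$ has fewer than two extrema, the trend is $r=s^{(m+1)}$. *)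

theory Defs
  imports Complex_Main "Jordan_Normal_Form.Matrix"
begin

definition per :: "'a vec \<Rightarrow> int \<Rightarrow> 'a" where
  "per s j = s $ nat (j mod int (dim_vec s))"

definition sample_time :: "real \<Rightarrow> nat \<Rightarrow> real" where
  "sample_time B j = real j / (2 * B)"

definition sampling_freq :: "real \<Rightarrow> nat \<Rightarrow> real" where
  "sampling_freq L k = real k / L"

text \<open>The transform at an arbitrary frequency. With \<open>dim_vec s = 2 * B * L\<close>, its value at
  \<open>sampling_freq L k\<close> has the kernel \<open>exp (- 2 * pi * \<i> * j * k / dim_vec s)\<close>.\<close>

definition dft :: "real \<Rightarrow> real vec \<Rightarrow> real \<Rightarrow> complex" where
  "dft B s \<xi> = (\<Sum>j<dim_vec s. complex_of_real (s $ j) *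
     exp (- 2 * complex_of_real pi * \<i> * complex_of_real (sample_time B j) * complex_of_real \<xi>))"

definition dft_vec :: "real \<Rightarrow> real \<Rightarrow> real vec \<Rightarrow> complex vec" where
  "dft_vec B L s = vec (dim_vec s) (\<lambda>k. dft B s (sampling_freq L k))"

definition norm2 :: "real \<Rightarrow> 'a::real_normed_vector vec \<Rightarrow> real" where
  "norm2 L a = L / real (dim_vec a) * sqrt (\<Sum>j<dim_vec a. (norm (a $ j))\<^sup>2)"

definition fourier_energy :: "real \<Rightarrow> real \<Rightarrow> real vec \<Rightarrow> real" where
  "fourier_energy B L s = (\<Sum>k<dim_vec s. cmod (dft B s (sampling_freq L k)))"

definition circ_conv :: "real vec \<Rightarrow> real vec \<Rightarrow> real vec" where
  "circ_conv w s = vec (dim_vec s) (\<lambda>i. \<Sum>j<dim_vec s. w $ j * per s (int i - int j))"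

definition is_filter :: "nat \<Rightarrow> real vec \<Rightarrow> bool" where
  "is_filter n w \<longleftrightarrow> w \<in> carrier_vec n \<and> (\<forall>j<n. 0 \<le> w $ j) \<and>
     (\<forall>j. per w (- j) = per w j) \<and> (\<Sum>j<n. w $ j) = 1"

definition double_conv_filter :: "nat \<Rightarrow> real vec \<Rightarrow> bool" where
  "double_conv_filter n w \<longleftrightarrow> (\<exists>v. is_filter n v \<and> w = circ_conv v v)"

definition variation :: "real vec \<Rightarrow> real vec \<Rightarrow> real vec" where
  "variation w s = s - circ_conv w s"

text \<open>A local maximum or minimum may be attained on a run of equal consecutive samples; such a
  run \<open>a..b\<close> counts as one extremum, represented by its first index. For the finite sample
  sequence the end samples are not extrema; for the periodic extension every index of one period
  is a candidate (and the run may continue past the end of the period).\<close>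

definition extremal_run :: "(int \<Rightarrow> real) \<Rightarrow> int \<Rightarrow> int \<Rightarrow> bool" where
  "extremal_run x a b \<longleftrightarrow> a \<le> b \<and> (\<forall>i\<in>{a..b}. x i = x a) \<and>
     (x (a - 1) < x a \<and> x (b + 1) < x a \<or> x (a - 1) > x a \<and> x (b + 1) > x a)"

definition interior_extrema :: "real vec \<Rightarrow> int set" where
  "interior_extrema s = {a. \<exists>b. 0 < a \<and> b < int (dim_vec s) - 1 \<and> extremal_run (per s) a b}"

definition periodic_extrema :: "real vec \<Rightarrow> int set" where
  "periodic_extrema s = {a. \<exists>b. 0 \<le> a \<and> a < int (dim_vec s) \<and> extremal_run (per s) a b}"

definition stopping_criterion ::
    "real \<Rightarrow> real \<Rightarrow> real \<Rightarrow> real vec \<Rightarrow> real vec \<Rightarrow> nat \<Rightarrow> bool" where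
  "stopping_criterion B L \<delta> w s p \<longleftrightarrow>
     norm2 L (dft_vec B L ((variation w ^^ (p + 1)) s) - dft_vec B L ((variation w ^^ p) s))
       \<le> \<delta> * norm2 L s"

text \<open>\<open>extrema\<close> is the convention for the set of extrema of a signal. The filters \<open>w k\<close>
  are arbitrary, so every rule for choosing them is covered.\<close>

definition fif_returns ::
    "(real vec \<Rightarrow> int set) \<Rightarrow> real \<Rightarrow> real \<Rightarrow> real \<Rightarrow> real vec \<Rightarrow> nat \<Rightarrow> (nat \<Rightarrow> real vec) \<Rightarrow> real vec \<Rightarrow> bool"
  where
  "fif_returns extrema B L \<delta> s m IMF r \<longleftrightarrow>
     (\<exists>S w p. S 1 = s \<and>
        (\<forall>k\<in>{1..m}.
           2 \<le> card (extrema (S k)) \<and>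
           double_conv_filter (dim_vec s) (w k) \<and>
           (1 \<le> p k \<and> stopping_criterion B L \<delta> (w k) (S k) (p k) \<and>
             (\<forall>q. 1 \<le> q \<and> q < p k \<longrightarrow> \<not> stopping_criterion B L \<delta> (w k) (S k) q)) \<and>
           IMF k = (variation (w k) ^^ p k) (S k) \<and>
           S (k + 1) = S k - IMF k) \<and>
        card (extrema (S (m + 1))) < 2 \<and>
        r = S (m + 1))"

end

theory Submission
  imports Defs
begin

text \<open>On the Fourier side every step of the algorithm acts by pointwise multiplication. The
  transform of an even filter of total mass 1 is real and of modulus at most 1, so that of a double
  convolution filter is its square and lies in \<open>[0,1]\<close>. Hence at each sampling frequency
  \<open>IMF k\<close> and \<open>S (k + 1)\<close> have transforms \<open>a * z\<close> and \<open>(1 - a) * z\<close>, where \<open>z\<close> is the transform of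
  \<open>S k\<close> and \<open>0 \<le> a \<le> 1\<close>. The moduli therefore add up at each step, and the sum over the steps
  telescopes.\<close>

text \<open>Multiplying by a unit and translating permutes the residues mod \<open>n\<close>. It is
  used twice: with \<open>u = 1\<close> to absorb the shift in a convolution, and with
  \<open>u = -1\<close> to reflect the sum of an even filter.\<close>

lemma sum_periodic_affine:
  fixes f :: "int \<Rightarrow> 'a::comm_monoid_add"
  assumes n: "n > 0" and per: "\<And>x. f (x mod int n) = f x" and u: "coprime u (int n)"
  shows "(\<Sum>i<n. f (u * int i + c)) = (\<Sum>i<n. f (int i))"
proof -
  define h where "h i = nat ((u * int i + c) mod int n)" for i
  have hi: "int (h i) = (u * int i + c) mod int n" for i
    using n by (simp add: h_def)
  have "inj_on h {..<n}"
  proof (rule inj_onI)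
    fix i j assume ij: "i \<in> {..<n}" "j \<in> {..<n}" and "h i = h j"
    then have "(u * int i + c) mod int n = (u * int j + c) mod int n"
      using hi by metis
    then have "int n dvd (u * int i + c) - (u * int j + c)"
      by (simp only: mod_eq_dvd_iff)
    then have "int n dvd u * (int i - int j)"
      by (simp add: algebra_simps)
    then have "int n dvd int i - int j"
      using u by (simp add: coprime_dvd_mult_right_iff coprime_commute)
    then have "int i mod int n = int j mod int n"
      by (simp only: mod_eq_dvd_iff)
    then show "i = j" using ij by simp
  qed
  moreover have "h ` {..<n} \<subseteq> {..<n}"
    using n by (auto simp: h_def nat_less_iff)
  ultimately have bij: "bij_betw h {..<n} {..<n}"
    by (simp add: bij_betw_def endo_inj_surj)
  have "(\<Sum>i<n. f (u * int i + c)) = (\<Sum>i<n. f (int (h i)))"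
    by (simp add: hi per)
  also have "\<dots> = (\<Sum>i<n. f (int i))"
    by (rule sum.reindex_bij_betw[OF bij])
  finally show ?thesis .
qed

lemma per_mod: "per s (x mod int (dim_vec s)) = per s x"
  by (simp add: per_def)

lemma per_nat: "i < dim_vec s \<Longrightarrow> per s (int i) = s $ i"
  by (simp add: per_def flip: of_nat_mod)

text \<open>The \<open>k\<close>-th character of the integers mod \<open>n\<close>. The argument is
  an \<open>int\<close> so that \<open>i - j\<close> and \<open>- j\<close> can be inserted without
  truncation.\<close>

definition dft_char :: "nat \<Rightarrow> nat \<Rightarrow> int \<Rightarrow> complex" where
  "dft_char n k j = cis (- (2 * pi * real k * real_of_int j / real n))"

lemma dft_char_add: "dft_char n k (i + j) = dft_char n k i * dft_char n k j"
  by (simp add: dft_char_def cis_mult add_divide_distrib distrib_left)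

lemma dft_char_uminus: "dft_char n k (- j) = cnj (dft_char n k j)"
  by (simp add: dft_char_def cis_cnj)

lemma norm_dft_char [simp]: "cmod (dft_char n k j) = 1"
  by (simp add: dft_char_def)

lemma dft_char_mod:
  assumes "n > 0"
  shows "dft_char n k (x mod int n) = dft_char n k x"
proof -
  have "dft_char n k (int n * (x div int n)) = cis (2 * pi * of_int (- (int k * (x div int n))))"
    using assms by (simp add: dft_char_def mult_ac)
  also have "\<dots> = 1"
    by (rule cis_multiple_2pi) simp
  finally show ?thesis
    using dft_char_add[of n k "int n * (x div int n)" "x mod int n"] by simp
qed

text \<open>Since \<open>2 * B * L\<close> is \<open>n\<close>, time times frequency is
  \<open>j * k / n\<close>. Writing the samples through \<open>per\<close> makes the summand an
  \<open>n\<close>-periodic function on \<open>int\<close>, the form that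
  \<open>sum_periodic_affine\<close> requires.\<close>

lemma dft_sampling_freq:
  assumes "L > 0" "real n = 2 * B * L" "dim_vec s = n"
  shows "dft B s (sampling_freq L k) = (\<Sum>j<n. of_real (per s (int j)) * dft_char n k (int j))"
proof -
  have "exp (- 2 * complex_of_real pi * \<i> * complex_of_real (sample_time B j) *
      complex_of_real (sampling_freq L k)) = dft_char n k (int j)" for j
  proof -
    have "- 2 * complex_of_real pi * \<i> * complex_of_real (sample_time B j) *
        complex_of_real (sampling_freq L k)
      = \<i> * complex_of_real (- (2 * pi * real k * real j / (2 * B * L)))"
      by (simp add: sample_time_def sampling_freq_def mult_ac)
    then show ?thesis
      using assms by (simp add: dft_char_def cis_conv_exp)
  qed
  then show ?thesis
    using assms(3) by (simp add: dft_def per_nat)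
qed

lemma dft_minus:
  assumes "dim_vec s = dim_vec t"
  shows "dft B (s - t) \<xi> = dft B s \<xi> - dft B t \<xi>"
  using assms by (simp add: dft_def sum_subtractf left_diff_distrib)

text \<open>The character at \<open>i\<close> factors into those at \<open>j\<close> and
  \<open>i - j\<close>. After the sums are exchanged, the inner one runs over a shifted full period,
  so it is \<open>?F\<close> for every \<open>j\<close>.\<close>

lemma dft_circ_conv:
  assumes "L > 0" "real n = 2 * B * L" "n > 0" "dim_vec w = n" "dim_vec s = n"
  shows "dft B (circ_conv w s) (sampling_freq L k)
    = dft B w (sampling_freq L k) * dft B s (sampling_freq L k)"
proof -
  let ?e = "dft_char n k"
  let ?F = "\<Sum>i<n. of_real (per s (int i)) * ?e (int i)"
  have dim: "dim_vec (circ_conv w s) = n"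
    using assms by (simp add: circ_conv_def)
  have shift: "(\<Sum>i<n. of_real (per s (int i - int j)) * ?e (int i - int j)) = ?F" for j
    using sum_periodic_affine[of n "\<lambda>x. of_real (per s x) * ?e x" 1 "- int j"] assms
    by (simp add: per_mod[of s, unfolded \<open>dim_vec s = n\<close>] dft_char_mod)
  have e: "x * y * ?e (int i) = x * ?e (int j) * (y * ?e (int i - int j))" for x y i j
    using dft_char_add[of n k "int j" "int i - int j"] by (simp add: mult_ac)
  have "dft B (circ_conv w s) (sampling_freq L k)
      = (\<Sum>i<n. of_real (\<Sum>j<n. per w (int j) * per s (int i - int j)) * ?e (int i))"
    using assms by (simp add: dft_sampling_freq[OF assms(1,2) dim] per_nat dim)
      (simp add: circ_conv_def)
  also have "\<dots> = (\<Sum>i<n. \<Sum>j<n. of_real (per w (int j)) * ?e (int j) *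
      (of_real (per s (int i - int j)) * ?e (int i - int j)))"
    unfolding of_real_sum sum_distrib_right
    by (intro sum.cong refl) (simp only: of_real_mult e)
  also have "\<dots> = (\<Sum>j<n. of_real (per w (int j)) * ?e (int j) * ?F)"
    by (subst sum.swap) (simp add: shift flip: sum_distrib_left)
  finally show ?thesis
    by (simp add: dft_sampling_freq[OF assms(1,2)] assms(4,5) sum_distrib_right)
qed

lemma dft_filter:
  assumes "L > 0" "real n = 2 * B * L" "n > 0" and v: "is_filter n v"
  shows "dft B v (sampling_freq L k) \<in> \<real>" "cmod (dft B v (sampling_freq L k)) \<le> 1"
proof -
  let ?e = "dft_char n k"
  have dim: "dim_vec v = n"
    using v by (simp add: is_filter_def)
  have dft: "dft B v (sampling_freq L k) = (\<Sum>j<n. of_real (per v (int j)) * ?e (int j))"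
    using assms dim by (simp add: dft_sampling_freq)
  \<comment> \<open>Conjugation reflects the character; evenness allows the weight to be reflected
    too, so the summand is one periodic function evaluated at \<open>- int j\<close>.\<close>
  have "cnj (dft B v (sampling_freq L k)) = (\<Sum>j<n. of_real (per v (- int j)) * ?e (- int j))"
    using v by (simp add: dft is_filter_def dft_char_uminus)
  also have "\<dots> = dft B v (sampling_freq L k)"
    using sum_periodic_affine[of n "\<lambda>x. of_real (per v x) * ?e x" "-1" 0] assms dim
    by (simp add: dft per_mod[of v, unfolded dim] dft_char_mod)
  finally show "dft B v (sampling_freq L k) \<in> \<real>"
    by (simp add: Reals_cnj_iff)
  \<comment> \<open>The characters have modulus 1 and the weights are nonnegative, so the triangle
    inequality leaves the total mass.\<close>
  have "cmod (dft B v (sampling_freq L k)) \<le> (\<Sum>j<n. cmod (of_real (per v (int j)) * ?e (int j)))"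
    unfolding dft by (rule norm_sum)
  also have "\<dots> = (\<Sum>j<n. v $ j)"
    using v dim by (intro sum.cong) (auto simp: norm_mult per_nat is_filter_def)
  finally show "cmod (dft B v (sampling_freq L k)) \<le> 1"
    using v by (simp add: is_filter_def)
qed

lemma dft_double_conv_filter:
  assumes "L > 0" "real n = 2 * B * L" "n > 0" and "double_conv_filter n w"
  obtains a where "0 \<le> a" "a \<le> 1" "dft B w (sampling_freq L k) = complex_of_real a"
proof -
  obtain v where v: "is_filter n v" "w = circ_conv v v"
    using assms(4) by (auto simp: double_conv_filter_def)
  obtain b where b: "dft B v (sampling_freq L k) = complex_of_real b"
    using dft_filter(1)[OF assms(1-3) v(1)] by (auto elim: Reals_cases)
  have "\<bar>b\<bar> \<le> 1"
    using dft_filter(2)[OF assms(1-3) v(1), of k] b by simp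
  then have "b\<^sup>2 \<le> 1"
    by (simp add: abs_square_le_1)
  \<comment> \<open>The square removes the sign of \<open>b\<close>. For a single filter
    \<open>b\<close> may be negative, and then \<open>1 - b\<close> exceeds 1.\<close>
  moreover have "dft B w (sampling_freq L k) = complex_of_real (b\<^sup>2)"
    using dft_circ_conv[OF assms(1-3), of v v k] v b
    by (simp add: is_filter_def power2_eq_square)
  ultimately show thesis
    using that[of "b\<^sup>2"] by simp
qed

lemma dim_variation_pow: "dim_vec ((variation w ^^ p) s) = dim_vec s"
  by (induction p) (simp_all add: variation_def circ_conv_def)

lemma dft_variation_pow:
  assumes "L > 0" "real n = 2 * B * L" "n > 0" "dim_vec w = n" "dim_vec s = n"
  shows "dft B ((variation w ^^ p) s) (sampling_freq L k)
    = (1 - dft B w (sampling_freq L k)) ^ p * dft B s (sampling_freq L k)"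
proof (induction p)
  case (Suc p)
  let ?t = "(variation w ^^ p) s"
  have dim: "dim_vec ?t = n"
    using assms by (simp add: dim_variation_pow)
  have "dim_vec (circ_conv w ?t) = dim_vec ?t"
    by (simp add: circ_conv_def)
  then have "dft B (variation w ?t) (sampling_freq L k)
      = (1 - dft B w (sampling_freq L k)) * dft B ?t (sampling_freq L k)"
    by (simp add: variation_def[of w ?t] dft_minus dft_circ_conv[OF assms(1-4) dim]
        left_diff_distrib)
  then show ?case
    using Suc by simp
qed simp

lemma cmod_dft_variation_pow_split:
  assumes "L > 0" "real n = 2 * B * L" "n > 0" "double_conv_filter n w" "dim_vec s = n"
  shows "cmod (dft B ((variation w ^^ p) s) (sampling_freq L k))
      + cmod (dft B (s - (variation w ^^ p) s) (sampling_freq L k))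
    = cmod (dft B s (sampling_freq L k))"
proof -
  obtain a where a: "0 \<le> a" "a \<le> 1" "dft B w (sampling_freq L k) = complex_of_real a"
    using dft_double_conv_filter[OF assms(1-4)] .
  \<comment> \<open>Here \<open>a\<close> is the transform of the filter; the multiplier that
    produces the IMF is \<open>c\<close>. It lies in [0,1] for every \<open>p\<close>, so the
    stopping index may be any number.\<close>
  define c where "c = (1 - a) ^ p"
  have c: "0 \<le> c" "c \<le> 1"
    using a by (auto simp: c_def power_le_one)
  have w: "dim_vec w = n"
    using assms(4) by (auto simp: double_conv_filter_def is_filter_def circ_conv_def)
  let ?z = "dft B s (sampling_freq L k)"
  have imf: "dft B ((variation w ^^ p) s) (sampling_freq L k) = of_real c * ?z"
    using dft_variation_pow[OF assms(1-3) w assms(5)] a by (simp add: c_def)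
  then have rest: "dft B (s - (variation w ^^ p) s) (sampling_freq L k) = of_real (1 - c) * ?z"
    by (simp add: dft_minus dim_variation_pow left_diff_distrib)
  show ?thesis
    unfolding imf rest norm_mult norm_of_real using c by (simp add: algebra_simps)
qed

lemma fif_returns_dim:
  assumes "fif_returns extrema B L \<delta> s m IMF r" "dim_vec s = n"
  shows "dim_vec r = n" "\<And>k. k \<in> {1..m} \<Longrightarrow> dim_vec (IMF k) = n"
proof -
  obtain S w p where S: "S 1 = s" "r = S (m + 1)"
    and step: "\<And>k. k \<in> {1..m} \<Longrightarrow> IMF k = (variation (w k) ^^ p k) (S k) \<and> S (k + 1) = S k - IMF k"
    using assms(1) unfolding fif_returns_def by blast
  \<comment> \<open>The index is shifted because \<open>S\<close> is only specified from 1 on; the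
    base case \<open>k = 0\<close> is the signal itself.\<close>
  have dim: "dim_vec (S (k + 1)) = n" if "k \<le> m" for k
    using that
  proof (induction k)
    case (Suc k)
    then show ?case
      using step[of "Suc k"] by (simp add: dim_variation_pow)
  qed (use S assms(2) in simp)
  show "dim_vec r = n"
    using dim[of m] S by simp
  show "dim_vec (IMF k) = n" if "k \<in> {1..m}" for k
    using dim[of "k - 1"] step[OF that] that by (cases k) (auto simp: dim_variation_pow)
qed

lemma fif_returns_cmod_dft:
  assumes "L > 0" "real n = 2 * B * L" "n > 0" "dim_vec s = n"
    and "fif_returns extrema B L \<delta> s m IMF r"
  shows "(\<Sum>k = 1..m. cmod (dft B (IMF k) (sampling_freq L l)))
      + cmod (dft B r (sampling_freq L l)) = cmod (dft B s (sampling_freq L l))"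
proof -
  obtain S w p where S: "S 1 = s" "r = S (m + 1)"
    and step: "\<And>k. k \<in> {1..m} \<Longrightarrow> double_conv_filter (dim_vec s) (w k)
      \<and> IMF k = (variation (w k) ^^ p k) (S k) \<and> S (k + 1) = S k - IMF k"
    using assms(5) unfolding fif_returns_def by blast
  \<comment> \<open>Loop invariant: after \<open>q\<close> steps the extracted moduli and that of
    the current remainder sum to the modulus for \<open>s\<close>. The dimension is carried along
    because the splitting lemma needs it.\<close>
  have "dim_vec (S (q + 1)) = n \<and> (\<Sum>k = 1..q. cmod (dft B (IMF k) (sampling_freq L l)))
      + cmod (dft B (S (q + 1)) (sampling_freq L l)) = cmod (dft B s (sampling_freq L l))"
    if "q \<le> m" for q
    using that
  proof (induction q)
    case (Suc q)
    then have "dim_vec (S (Suc q)) = n"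
      by simp
    then show ?case
      using Suc step[of "Suc q"] assms(4)
        cmod_dft_variation_pow_split[OF assms(1-3), of "w (Suc q)" "S (Suc q)" "p (Suc q)" l]
      by (simp add: dim_variation_pow)
  qed (use S assms(4) in simp)
  from this[of m] show ?thesis
    using S by simp
qed

theorem theorem2:
  fixes n m :: nat and B L \<delta> :: real and s r :: "real vec" and IMF :: "nat \<Rightarrow> real vec"
    and extrema :: "real vec \<Rightarrow> int set"
  assumes "B > 0" and "L > 0" and "real n = 2 * B * L"
    and "s \<in> carrier_vec n" and "\<delta> > 0"
    and "extrema \<in> {interior_extrema, periodic_extrema}"
    and "fif_returns extrema B L \<delta> s m IMF r"
  shows "fourier_energy B L s = (\<Sum>k = 1..m. fourier_energy B L (IMF k)) + fourier_energy B L r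
    \<and> (\<forall>\<xi> \<in> sampling_freq L ` {..<n}.
          (\<Sum>k = 1..m. cmod (dft B (IMF k) \<xi>)) + cmod (dft B r \<xi>) \<le> cmod (dft B s \<xi>))"
proof -
  have "real n > 0"
    unfolding assms(3) using assms(1,2) by simp
  then have n: "n > 0"
    by simp
  have s: "dim_vec s = n"
    using assms(4) by simp
  \<comment> \<open>This equality at each sampling frequency gives (ii) directly and (i) after
    summation over the frequencies.\<close>
  note eq = fif_returns_cmod_dft[OF assms(2,3) n s assms(7)]
  note dim = fif_returns_dim[OF assms(7) s]
  have "fourier_energy B L s = (\<Sum>l<n. (\<Sum>k = 1..m. cmod (dft B (IMF k) (sampling_freq L l)))
      + cmod (dft B r (sampling_freq L l)))"
    by (simp only: fourier_energy_def s eq)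
  also have "\<dots> = (\<Sum>k = 1..m. fourier_energy B L (IMF k)) + fourier_energy B L r"
    \<comment> \<open>Each energy sums over the dimension of its own vector; \<open>dim\<close>
      makes all these ranges equal to \<open>n\<close> so that the sums can be exchanged.\<close>
    using dim by (simp add: fourier_energy_def sum.distrib sum.swap[of _ "{..<n}"])
  finally show ?thesis
    using eq by auto
qed

end
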